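(* Let $\mathbb E$, $f,g,h,\phi$, $F=f+g-h$ and the constants $L>0$, $l\ge 0$, $\delta\in(0,1)$ satisfy the standing assumptions (a)--(d) listed in the context, and let $\{x^k\}$ be any sequence generated by the DCAe algorithm described in the context. Then the following statements hold. (a) For every $k=0,1,2,\dots$, $$F(x^{k+1}) \le F(x^k) + \delta L\, D_\phi(x^{k-1},x^k) - L\, D_\phi(x^k,x^{k+1}).$$ (b) $\sum_{k=0}^{+\infty}\|x^k-x^{k-1}\|^2<+\infty$, and thus $\lim_{k\to+\infty}\|x^k-x^{k-1}\|=0$. (c) If $x^*$ is a limit point of $\{x^k\}$, then $x^*$ is a critical point of the problem $\min_{x\in\mathbb E}F(x)$.
   Context: $\mathbb E$ is a finite-dimensional real linear space with inner product $\langle\cdot,\cdot\rangle$ and induced norm $\|\cdot\|$. The problem considered is $$\min_{x\in\mathbb E} F(x):=f(x)+g(x)-h(x).$$ Standing assumptions: (a) $f:\mathbb E\to\mathbb R$ is a (possibly nonconvex) continuously differentiable function, and $\phi:\mathbb E\to\mathbb R$ is a strongly convex continuously differentiable function such that $L\phi-f$ and $l\phi+f$ are convex, where $L>0$ and $l\ge 0$ are constants. (b) $g:\mathbb E\to\mathbb R\cup\{+\infty\}$ is a proper, lower semicontinuous, convex function. (c) $h:\mathbb E\to\mathbb R$ is a convex function. (d) $F$ is bounded from below. A function $J$ is strongly convex if $J-(\rho/2)\|\cdot\|^2$ is convex for some $\rho>0$. Define $D_\phi(x,y):=\phi(x)-[\phi(y)+\langle\nabla\phi(y),x-y\rangle]$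 and $G(x):=L\phi(x)+g(x)$. For a convex function $J$, $\partial J(x)=\{y: J(z)\ge J(x)+\langle z-x,y\rangle\ \forall z\in\mathbb E\}$ denotes the convex subdifferential. A point $x^*$ is a critical point of the problem if $[\nabla f(x^* )+\partial g(x^* )]\cap\partial h(x^* )\ne\emptyset$. DCAe algorithm: choose $x^0=x^{-1}\in\mathbb E$ and $\delta\in(0,1)$, with $L,l$ as in assumption (a). For $k=0,1,2,\dots$: 1. Compute $y^k=x^k+\beta_k(x^k-x^{k-1})$, where the extrapolation parameter $\beta_k$ satisfies $(L+l)D_\phi(x^k,y^k)\le\delta L\,D_\phi(x^{k-1},x^k)$. 2. Choose $\xi^k\in\partial h(x^k)$ and let $x^{k+1}$ be a solution of the convex problem $\min_{x\in\mathbb E}\{G(x)-\langle L\nabla\phi(y^k)-\nabla f(y^k)+\xi^k,\,x\rangle\}$. *)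

theory Defs
  imports "HOL-Analysis.Analysis"
begin

text \<open>Meaningful only where \<open>f\<close> is differentiable.\<close>

definition grad :: "('a::euclidean_space \<Rightarrow> real) \<Rightarrow> 'a \<Rightarrow> 'a" where
  "grad f x = (THE D. GDERIV f x :> D)"

definition continuously_differentiable :: "('a::euclidean_space \<Rightarrow> real) \<Rightarrow> bool" where
  "continuously_differentiable f \<longleftrightarrow>
     (\<forall>x. GDERIV f x :> grad f x) \<and> continuous_on UNIV (grad f)"

definition strongly_convex :: "('a::euclidean_space \<Rightarrow> real) \<Rightarrow> bool" where
  "strongly_convex J \<longleftrightarrow> (\<exists>\<rho>>0. convex_on UNIV (\<lambda>x. J x - \<rho> / 2 * (norm x)\<^sup>2))"

definition bregman :: "('a::euclidean_space \<Rightarrow> real) \<Rightarrow> 'a \<Rightarrow> 'a \<Rightarrow> real" where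
  "bregman \<phi> x y = \<phi> x - (\<phi> y + grad \<phi> y \<bullet> (x - y))"

definition proper :: "('a \<Rightarrow> ereal) \<Rightarrow> bool" where
  "proper g \<longleftrightarrow> (\<forall>x. g x \<noteq> -\<infinity>) \<and> (\<exists>x. g x \<noteq> \<infinity>)"

definition lsc :: "('a::topological_space \<Rightarrow> ereal) \<Rightarrow> bool" where
  "lsc g \<longleftrightarrow> (\<forall>x. g x \<le> Liminf (at x) g)"

text \<open>Intended for functions that never take the value \<open>-\<infinity>\<close>; note \<open>0 * \<infinity> = 0\<close> in \<open>ereal\<close>,
  so the cases \<open>u = 0\<close> and \<open>v = 0\<close> impose nothing.\<close>

definition ereal_convex :: "('a::real_vector \<Rightarrow> ereal) \<Rightarrow> bool" where
  "ereal_convex g \<longleftrightarrow> (\<forall>x y. \<forall>u\<ge>0. \<forall>v\<ge>0. u + v = 1 \<longrightarrow>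
     g (u *\<^sub>R x + v *\<^sub>R y) \<le> ereal u * g x + ereal v * g y)"

text \<open>For proper \<open>J\<close> this is empty wherever \<open>J x = \<infinity>\<close>.\<close>

definition subdiff :: "('a::euclidean_space \<Rightarrow> ereal) \<Rightarrow> 'a \<Rightarrow> 'a set" where
  "subdiff J x = {y. \<forall>z. J z \<ge> J x + ereal ((z - x) \<bullet> y)}"

definition objective ::
  "('a \<Rightarrow> real) \<Rightarrow> ('a \<Rightarrow> ereal) \<Rightarrow> ('a \<Rightarrow> real) \<Rightarrow> 'a \<Rightarrow> ereal" where
  "objective f g h x = ereal (f x) + g x - ereal (h x)"

definition critical_point ::
  "('a::euclidean_space \<Rightarrow> real) \<Rightarrow> ('a \<Rightarrow> ereal) \<Rightarrow> ('a \<Rightarrow> real) \<Rightarrow> 'a \<Rightarrow> bool" where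
  "critical_point f g h x \<longleftrightarrow>
     ((\<lambda>u. grad f x + u) ` subdiff g x) \<inter> subdiff (\<lambda>z. ereal (h z)) x \<noteq> {}"

text \<open>The term \<open>x\<^sup>k\<^sup>-\<^sup>1\<close>, with the convention \<open>x\<^sup>-\<^sup>1 = x\<^sup>0\<close>.\<close>

definition prev :: "(nat \<Rightarrow> 'a) \<Rightarrow> nat \<Rightarrow> 'a" where
  "prev x k = (case k of 0 \<Rightarrow> x 0 | Suc j \<Rightarrow> x j)"

definition DCAe_sequence ::
  "('a::euclidean_space \<Rightarrow> real) \<Rightarrow> ('a \<Rightarrow> ereal) \<Rightarrow> ('a \<Rightarrow> real) \<Rightarrow> ('a \<Rightarrow> real)
    \<Rightarrow> real \<Rightarrow> real \<Rightarrow> real \<Rightarrow> (nat \<Rightarrow> 'a) \<Rightarrow> bool" where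
  "DCAe_sequence f g h \<phi> L l \<delta> x \<longleftrightarrow>
     (\<forall>k. \<exists>\<beta> y \<xi>.
        y = x k + \<beta> *\<^sub>R (x k - prev x k) \<and>
        (L + l) * bregman \<phi> (x k) y \<le> \<delta> * L * bregman \<phi> (prev x k) (x k) \<and>
        \<xi> \<in> subdiff (\<lambda>z. ereal (h z)) (x k) \<and>
        is_arg_min
          (\<lambda>z. (ereal (L * \<phi> z) + g z) - ereal ((L *\<^sub>R grad \<phi> y - grad f y + \<xi>) \<bullet> z))
          (\<lambda>z. True) (x (Suc k)))"

definition sequence_limit_point :: "(nat \<Rightarrow> 'a::topological_space) \<Rightarrow> 'a \<Rightarrow> bool" where
  "sequence_limit_point x p \<longleftrightarrow> (\<exists>r. strict_mono r \<and> (x \<circ> r) \<longlonglongrightarrow> p)"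

end

theory Submission
  imports Defs
begin

text \<open>
  The whole argument rests on one first-order principle
  (\<open>minimizer_of_differentiable_plus_convex\<close>): if \<open>x\<close> minimises \<open>q + g\<close> with \<open>g\<close> convex and \<open>q\<close>
  merely differentiable at \<open>x\<close>, then \<open>- grad q x\<close> is a subgradient of \<open>g\<close> at \<open>x\<close>. Applied to the
  subproblem it says that \<open>L\<nabla>\<phi>(y\<^sup>k) - \<nabla>f(y\<^sup>k) + \<xi>\<^sup>k - L\<nabla>\<phi>(x\<^sup>k\<^sup>+\<^sup>1)\<close> is a subgradient of \<open>g\<close> at
  \<open>x\<^sup>k\<^sup>+\<^sup>1\<close>; applied to the difference of a convex function and itself it gives the tangent
  inequality, hence \<open>- l D\<^sub>\<phi>(x,y) \<le> f(x) - f(y) - \<nabla>f(y) \<bullet> (x - y) \<le> L D\<^sub>\<phi>(x,y)\<close> as well as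
  \<open>D\<^sub>\<phi>(x,y) \<ge> \<rho>/2 \<parallel>x - y\<parallel>\<^sup>2\<close>.

  Descent: add the subgradient inequalities for \<open>g\<close> and \<open>h\<close> to the two bounds for \<open>f\<close> around
  \<open>y\<^sup>k\<close>. All gradients of \<open>f\<close> and all \<open>\<xi>\<^sup>k\<close> cancel, and by the three-point identity for \<open>D\<^sub>\<phi>\<close> what
  is left is \<open>F(x\<^sup>k\<^sup>+\<^sup>1) \<le> F(x\<^sup>k) + (L + l) D\<^sub>\<phi>(x\<^sup>k,y\<^sup>k) - L D\<^sub>\<phi>(x\<^sup>k,x\<^sup>k\<^sup>+\<^sup>1)\<close>; the extrapolation rule
  bounds the middle term.

  Summability: since \<open>\<delta> < 1\<close>, the descent inequality telescopes to a bound for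
  \<open>(1 - \<delta>) L \<Sum> D\<^sub>\<phi>(x\<^sup>k\<^sup>-\<^sup>1,x\<^sup>k)\<close>. The starting point may lie outside the domain of \<open>g\<close>, so the
  telescoping starts at \<open>x\<^sup>1\<close>.

  Criticality: along \<open>x\<^sup>k \<rightarrow> p\<close> also \<open>x\<^sup>k\<^sup>+\<^sup>1\<close> and \<open>y\<^sup>k\<close> tend to \<open>p\<close>. The corresponding \<open>\<xi>\<^sup>k\<close> are bounded, as
  subgradients of a finite convex function over a bounded set, so a further subsequence tends to
  some \<open>\<xi>\<close>. Graphs of subdifferentials of lower semicontinuous functions are closed
  (\<open>subdiff_limit\<close>), so \<open>\<xi>\<close> is a subgradient of \<open>h\<close> at \<open>p\<close>, and \<open>\<xi> - \<nabla>f(p)\<close>, in which the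
  \<open>\<phi>\<close>-terms cancel by continuity of \<open>\<nabla>\<phi>\<close>, is one of \<open>g\<close>.
\<close>

section \<open>First-order conditions\<close>

text \<open>Moving from \<open>x\<close> a fraction \<open>t\<close> of the way to \<open>z\<close> raises \<open>g\<close> by at most \<open>t (g z - g x)\<close>, so
  minimality makes the difference quotient of \<open>q\<close> at least \<open>g x - g z\<close>; let \<open>t\<close> tend to \<open>0\<close>.
  The tangent inequality below is the case of a concave \<open>q\<close>.\<close>

lemma minimizer_of_differentiable_plus_convex:
  fixes q :: "'a::euclidean_space \<Rightarrow> real" and g :: "'a \<Rightarrow> ereal"
  assumes conv: "ereal_convex g"
    and fin: "\<bar>g x\<bar> \<noteq> \<infinity>"
    and not_minf: "\<And>z. g z \<noteq> - \<infinity>"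
    and grad_q: "GDERIV q x :> D"
    and min: "\<And>z. ereal (q x) + g x \<le> ereal (q z) + g z"
  shows "- D \<in> subdiff g x"
proof -
  obtain a where a: "g x = ereal a" using fin by (cases "g x") auto
  have "g x + ereal ((z - x) \<bullet> (- D)) \<le> g z" for z
  proof (cases "g z")
    case (real b)
    let ?r = "\<lambda>t. q (x + t *\<^sub>R (z - x))"
    have quot: "a - b \<le> (?r t - ?r 0) / t" if t: "0 < t" "t < 1" for t
    proof -
      have pt: "x + t *\<^sub>R (z - x) = (1 - t) *\<^sub>R x + t *\<^sub>R z" by (simp add: algebra_simps)
      have "g (x + t *\<^sub>R (z - x)) \<le> ereal (1 - t) * g x + ereal t * g z"
        unfolding pt using conv t unfolding ereal_convex_def by simp
      also have "\<dots> = ereal ((1 - t) * a + t * b)" by (simp add: a real)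
      finally have le: "g (x + t *\<^sub>R (z - x)) \<le> ereal ((1 - t) * a + t * b)" .
      have "ereal (q x + a) \<le> ereal (?r t) + g (x + t *\<^sub>R (z - x))"
        using min[of "x + t *\<^sub>R (z - x)"] by (simp add: a)
      also have "\<dots> \<le> ereal (?r t + ((1 - t) * a + t * b))"
        using add_left_mono[OF le, of "ereal (?r t)"] by simp
      finally have "q x + a \<le> ?r t + ((1 - t) * a + t * b)" by simp
      then have "(a - b) * t \<le> ?r t - ?r 0" by (simp add: algebra_simps)
      then show ?thesis using t by (simp add: pos_le_divide_eq)
    qed
    have "((\<lambda>t. x + t *\<^sub>R (z - x)) has_derivative (\<lambda>t. t *\<^sub>R (z - x))) (at (0::real))"
      by (auto intro!: derivative_eq_intros)
    moreover have "(q has_derivative (\<lambda>h. h \<bullet> D)) (at (x + 0 *\<^sub>R (z - x)))"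
      using grad_q by (simp add: gderiv_def)
    ultimately have "(?r has_derivative (\<lambda>t. (t *\<^sub>R (z - x)) \<bullet> D)) (at 0)"
      by (rule has_derivative_compose)
    then have "(?r has_real_derivative ((z - x) \<bullet> D)) (at 0)"
      by (simp add: has_field_derivative_def mult.commute[of _ "_ \<bullet> D"])
    then have "(\<lambda>t. (?r t - ?r 0) / t) \<midarrow>0\<rightarrow> (z - x) \<bullet> D"
      by (simp add: DERIV_def)
    then have "((\<lambda>t. (?r t - ?r 0) / t) \<longlongrightarrow> (z - x) \<bullet> D) (at_right 0)"
      by (rule tendsto_mono[OF at_le, rotated]) simp
    moreover have "eventually (\<lambda>t. a - b \<le> (?r t - ?r 0) / t) (at_right 0)"
      using quot unfolding eventually_at_right[OF zero_less_one] by (intro exI[of _ 1]) simp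
    ultimately have "a - b \<le> (z - x) \<bullet> D"
      by (rule tendsto_lowerbound) simp
    then show ?thesis by (simp add: a real)
  qed (use not_minf[of z] in auto)
  then show ?thesis by (simp add: subdiff_def)
qed

text \<open>Every point minimises \<open>- q + q\<close>.\<close>

lemma convex_above_tangent:
  fixes q :: "'a::euclidean_space \<Rightarrow> real"
  assumes conv: "convex_on UNIV q" and grad_q: "GDERIV q y :> D"
  shows "q y + D \<bullet> (x - y) \<le> q x"
proof -
  have "ereal_convex (\<lambda>z. ereal (q z))"
    using conv by (auto simp: ereal_convex_def convex_on_def)
  moreover have "GDERIV (\<lambda>z. - q z) y :> - D"
    using grad_q by (rule GDERIV_minus)
  ultimately have "- (- D) \<in> subdiff (\<lambda>z. ereal (q z)) y"
    by (intro minimizer_of_differentiable_plus_convex[where q = "\<lambda>z. - q z"]) auto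
  then have "ereal (q y) + ereal ((x - y) \<bullet> D) \<le> ereal (q x)"
    by (simp add: subdiff_def)
  then show ?thesis by (simp add: inner_commute)
qed

section \<open>Bregman distances\<close>

lemma strongly_convex_bregman_ge:
  fixes \<phi> :: "'a::euclidean_space \<Rightarrow> real"
  assumes "strongly_convex \<phi>" and diff: "\<And>y. GDERIV \<phi> y :> grad \<phi> y"
  obtains \<rho> where "\<rho> > 0" "\<And>x y. \<rho> / 2 * (norm (x - y))\<^sup>2 \<le> bregman \<phi> x y"
proof -
  obtain \<rho> where \<rho>: "\<rho> > 0" and conv: "convex_on UNIV (\<lambda>x. \<phi> x - \<rho> / 2 * (norm x)\<^sup>2)"
    using assms(1) by (auto simp: strongly_convex_def)
  have "\<rho> / 2 * (norm (x - y))\<^sup>2 \<le> bregman \<phi> x y" for x y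
  proof -
    have "GDERIV (\<lambda>z. \<phi> z - \<rho> / 2 * (z \<bullet> z)) y :> grad \<phi> y - \<rho> *\<^sub>R y"
      using diff[of y] unfolding gderiv_def
      by (auto intro!: derivative_eq_intros simp: inner_diff_right inner_commute)
    from convex_above_tangent[OF conv[unfolded power2_norm_eq_inner] this, of x]
    show ?thesis
      by (simp add: bregman_def power2_norm_eq_inner inner_commute algebra_simps)
  qed
  with \<rho> show ?thesis by (rule that)
qed

text \<open>Relative smoothness: convexity of \<open>c \<phi> + s f\<close> is a one-sided bound on the linearisation
  error of \<open>f\<close>. The sign \<open>s = - 1\<close> gives the upper bound and \<open>s = 1\<close> the lower one.\<close>

lemma linearization_error_le_bregman:
  fixes f \<phi> :: "'a::euclidean_space \<Rightarrow> real"
  assumes "GDERIV f y :> grad f y" and "GDERIV \<phi> y :> grad \<phi> y"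
    and "convex_on UNIV (\<lambda>z. c * \<phi> z + s * f z)"
  shows "- s * (f x - (f y + grad f y \<bullet> (x - y))) \<le> c * bregman \<phi> x y"
proof -
  have "GDERIV (\<lambda>z. c * \<phi> z + s * f z) y :> c *\<^sub>R grad \<phi> y + s *\<^sub>R grad f y"
    using assms(1,2) unfolding gderiv_def
    by (auto intro!: derivative_eq_intros simp: inner_add_right)
  from convex_above_tangent[OF assms(3) this, of x] show ?thesis
    by (simp add: bregman_def inner_add_left algebra_simps)
qed

section \<open>Limits of subgradients\<close>

text \<open>If the subgradient inequality failed at \<open>z\<close> in the limit, a real \<open>c\<close> would separate
  \<open>g z - (z - p) \<bullet> u\<close> from \<open>g p\<close>. Lower semicontinuity keeps \<open>c\<close> below \<open>g (X n)\<close>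
  eventually, and the inequalities along the sequence then contradict the choice of \<open>c\<close>.\<close>

lemma subdiff_limit:
  fixes g :: "'a::euclidean_space \<Rightarrow> ereal"
  assumes "lsc g" and X: "X \<longlonglongrightarrow> p" and U: "U \<longlonglongrightarrow> u"
    and sub: "\<And>n. U n \<in> subdiff g (X n)"
  shows "u \<in> subdiff g p"
proof -
  have "g p + ereal ((z - p) \<bullet> u) \<le> g z" for z
  proof (rule ccontr)
    assume "\<not> ?thesis"
    then have "g z - ereal ((z - p) \<bullet> u) < g p"
      by (cases "g z"; cases "g p") auto
    then obtain c where c: "g z - ereal ((z - p) \<bullet> u) < ereal c" "ereal c < g p"
      using ereal_dense2 by blast
    have "ereal c < Liminf (at p) g"
      using c(2) assms(1) by (auto simp: lsc_def intro: less_le_trans)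
    then have "eventually (\<lambda>w. ereal c < g w) (at p)"
      by (rule less_LiminfD)
    then have "eventually (\<lambda>w. ereal c < g w) (nhds p)"
      using c(2) by (simp add: eventually_nhds_conv_at)
    then have "eventually (\<lambda>n. ereal c < g (X n)) sequentially"
      using X unfolding filterlim_iff by blast
    then have ev: "eventually (\<lambda>n. ereal (c + (z - X n) \<bullet> U n) \<le> g z) sequentially"
    proof (rule eventually_mono)
      fix n assume n: "ereal c < g (X n)"
      have "ereal (c + (z - X n) \<bullet> U n) \<le> g (X n) + ereal ((z - X n) \<bullet> U n)"
        using add_right_mono[OF less_imp_le[OF n], of "ereal ((z - X n) \<bullet> U n)"] by simp
      also have "\<dots> \<le> g z" using sub[of n] by (simp add: subdiff_def)
      finally show "ereal (c + (z - X n) \<bullet> U n) \<le> g z" .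
    qed
    have "(\<lambda>n. ereal (c + (z - X n) \<bullet> U n)) \<longlonglongrightarrow> ereal (c + (z - p) \<bullet> u)"
      using X U by (intro tendsto_intros)
    then have "ereal (c + (z - p) \<bullet> u) \<le> g z"
      using ev by (rule tendsto_upperbound) simp
    then show False using c(1) by (cases "g z") auto
  qed
  then show ?thesis by (simp add: subdiff_def)
qed

lemma continuous_imp_lsc:
  fixes h :: "'a::euclidean_space \<Rightarrow> real"
  assumes "continuous_on UNIV h"
  shows "lsc (\<lambda>z. ereal (h z))"
  unfolding lsc_def
proof
  fix x
  have "(h \<longlongrightarrow> h x) (at x)"
    using assms by (simp add: continuous_on_def)
  then have "Liminf (at x) (\<lambda>z. ereal (h z)) = ereal (h x)"
    by (intro lim_imp_Liminf) auto
  then show "ereal (h x) \<le> Liminf (at x) (\<lambda>z. ereal (h z))" by simp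
qed

text \<open>Testing a subgradient \<open>v\<close> one unit step in its own direction bounds \<open>norm v\<close> by the
  increase of \<open>h\<close>, and \<open>h\<close> is bounded on bounded sets.\<close>

lemma subgradients_bounded:
  fixes h :: "'a::euclidean_space \<Rightarrow> real"
  assumes cont: "continuous_on UNIV h" and S: "bounded S"
  shows "bounded (\<Union>x\<in>S. subdiff (\<lambda>z. ereal (h z)) x)"
proof -
  obtain B where B: "\<And>x. x \<in> S \<Longrightarrow> norm x \<le> B"
    using S by (auto simp: bounded_iff)
  have "bounded (h ` cball 0 (B + 1))"
    by (intro compact_imp_bounded compact_continuous_image continuous_on_subset[OF cont]) auto
  then obtain M where M: "\<And>w. norm w \<le> B + 1 \<Longrightarrow> \<bar>h w\<bar> \<le> M"
    unfolding bounded_iff by fastforce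
  have "norm v \<le> 2 * M" if x: "x \<in> S" and v: "v \<in> subdiff (\<lambda>z. ereal (h z)) x" for x v
  proof -
    have "norm (x + sgn v) \<le> B + 1"
      using B[OF x] norm_triangle_ineq[of x "sgn v"] by (simp add: norm_sgn split: if_splits)
    moreover have "norm x \<le> B + 1" using B[OF x] by simp
    ultimately have "\<bar>h (x + sgn v)\<bar> \<le> M" "\<bar>h x\<bar> \<le> M" using M by auto
    moreover have "ereal (h x) + ereal ((x + sgn v - x) \<bullet> v) \<le> ereal (h (x + sgn v))"
      using v unfolding subdiff_def by blast
    moreover have "sgn v \<bullet> v = norm v"
      by (cases "v = 0") (simp_all add: sgn_div_norm power2_norm_eq_inner[symmetric] power2_eq_square)
    ultimately show ?thesis by simp
  qed
  then show ?thesis by (auto simp: bounded_iff)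
qed

section \<open>One step of the algorithm\<close>

lemma subproblem_optimality:
  fixes \<phi> :: "'a::euclidean_space \<Rightarrow> real" and g :: "'a \<Rightarrow> ereal"
  assumes "proper g" and "ereal_convex g" and diff: "GDERIV \<phi> w :> grad \<phi> w"
    and min: "is_arg_min (\<lambda>z. (ereal (L * \<phi> z) + g z) - ereal (v \<bullet> z)) (\<lambda>z. True) w"
  shows "\<bar>g w\<bar> \<noteq> \<infinity>" and "v - L *\<^sub>R grad \<phi> w \<in> subdiff g w"
proof -
  let ?q = "\<lambda>z. L * \<phi> z - v \<bullet> z"
  have not_minf: "g z \<noteq> - \<infinity>" for z using assms(1) by (simp add: proper_def)
  have "(ereal (L * \<phi> z) + g z) - ereal (v \<bullet> z) = ereal (?q z) + g z" for z
    by (cases "g z") auto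
  then have le: "ereal (?q w) + g w \<le> ereal (?q z) + g z" for z
    using min by (simp add: is_arg_min_def not_less)
  obtain z0 where "g z0 \<noteq> \<infinity>" using assms(1) by (auto simp: proper_def)
  then show fin: "\<bar>g w\<bar> \<noteq> \<infinity>" using le[of z0] not_minf[of w] not_minf[of z0]
    by (cases "g w"; cases "g z0") auto
  have "GDERIV ?q w :> L *\<^sub>R grad \<phi> w - v"
    using diff unfolding gderiv_def
    by (auto intro!: derivative_eq_intros simp: inner_diff_right inner_commute)
  from minimizer_of_differentiable_plus_convex[OF assms(2) fin not_minf this le]
  show "v - L *\<^sub>R grad \<phi> w \<in> subdiff g w" by simp
qed

text \<open>The three-point identity
  \<open>D\<^sub>\<phi>(x,y) - D\<^sub>\<phi>(w,y) - D\<^sub>\<phi>(x,w) = (\<nabla>\<phi>(y) - \<nabla>\<phi>(w)) \<bullet> (w - x)\<close> is what combines the inner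
  products left over from the subgradient inequality of \<open>g\<close>.\<close>

lemma descent_step:
  fixes f h \<phi> :: "'a::euclidean_space \<Rightarrow> real" and g :: "'a \<Rightarrow> ereal"
  assumes upper: "f w - (f y + grad f y \<bullet> (w - y)) \<le> L * bregman \<phi> w y"
    and lower: "- (f x - (f y + grad f y \<bullet> (x - y))) \<le> l * bregman \<phi> x y"
    and \<xi>: "\<xi> \<in> subdiff (\<lambda>z. ereal (h z)) x"
    and fin: "\<bar>g w\<bar> \<noteq> \<infinity>"
    and sub: "L *\<^sub>R grad \<phi> y - grad f y + \<xi> - L *\<^sub>R grad \<phi> w \<in> subdiff g w"
    and extrapolation: "(L + l) * bregman \<phi> x y \<le> e"
  shows "objective f g h w \<le> objective f g h x + ereal e - ereal (L * bregman \<phi> x w)"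
proof -
  obtain b where b: "g w = ereal b" using fin by (cases "g w") auto
  let ?u = "L *\<^sub>R grad \<phi> y - grad f y + \<xi> - L *\<^sub>R grad \<phi> w"
  have gx: "ereal (b + (x - w) \<bullet> ?u) \<le> g x"
    using sub by (simp add: subdiff_def b)
  have hw: "h x + (w - x) \<bullet> \<xi> \<le> h w"
    using \<xi> by (simp add: subdiff_def)
  show ?thesis
  proof (cases "g x")
    case (real a)
    have "b + (x - w) \<bullet> ?u \<le> a" using gx real by simp
    moreover have "(x - w) \<bullet> ?u = L * (grad \<phi> y \<bullet> (x - w)) - L * (grad \<phi> w \<bullet> (x - w))
        - grad f y \<bullet> (x - w) - (w - x) \<bullet> \<xi>"
      by (simp add: algebra_simps inner_commute)
    moreover have "grad f y \<bullet> (w - y) - grad f y \<bullet> (x - y) = - (grad f y \<bullet> (x - w))"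
      by (simp add: algebra_simps)
    moreover have "L * bregman \<phi> x y - L * bregman \<phi> w y - L * bregman \<phi> x w
        = L * (grad \<phi> w \<bullet> (x - w)) - L * (grad \<phi> y \<bullet> (x - w))"
      by (simp add: bregman_def algebra_simps)
    moreover have "L * bregman \<phi> x y + l * bregman \<phi> x y \<le> e"
      using extrapolation by (simp add: distrib_right)
    ultimately have "f w + b - h w \<le> f x + a - h x + e - L * bregman \<phi> x w"
      using upper lower hw by linarith
    then show ?thesis by (simp add: objective_def b real)
  qed (use gx in \<open>auto simp: objective_def\<close>)
qed

section \<open>Summation and convergence\<close>

text \<open>By induction the potential satisfies
  \<open>(1 - \<delta>) (d 0 + \<dots> + d (n - 1)) + a n + d n \<le> a 0 + d 0\<close>.\<close>

lemma summable_of_perturbed_descent: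
  fixes a d :: "nat \<Rightarrow> real"
  assumes step: "\<And>n. a (Suc n) \<le> a n + \<delta> * d n - d (Suc n)"
    and bound: "\<And>n. m \<le> a n" and nonneg: "\<And>n. 0 \<le> d n" and \<delta>: "\<delta> < 1"
  shows "summable d"
proof (rule summableI_nonneg_bounded)
  fix n
  have "(1 - \<delta>) * (\<Sum>k<n. d k) \<le> a 0 - a n + d 0 - d n"
  proof (induction n)
    case (Suc n)
    then show ?case using step[of n] by (simp add: algebra_simps)
  qed simp
  also have "\<dots> \<le> a 0 - m + d 0" using bound[of n] nonneg[of n] by simp
  finally show "(\<Sum>k<n. d k) \<le> (a 0 - m + d 0) / (1 - \<delta>)"
    using \<delta> by (simp add: pos_le_divide_eq mult.commute)
qed (use nonneg in auto)

theorem theorem3p1: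
  fixes f h \<phi> :: "'a::euclidean_space \<Rightarrow> real"
    and g :: "'a \<Rightarrow> ereal"
    and L l \<delta> :: real
    and x :: "nat \<Rightarrow> 'a"
  assumes "continuously_differentiable f"
    and "continuously_differentiable \<phi>" and "strongly_convex \<phi>"
    and "L > 0" and "l \<ge> 0"
    and "convex_on UNIV (\<lambda>z. L * \<phi> z - f z)"
    and "convex_on UNIV (\<lambda>z. l * \<phi> z + f z)"
    and "proper g" and "lsc g" and "ereal_convex g"
    and "convex_on UNIV h"
    and "\<exists>m::real. \<forall>z. ereal m \<le> objective f g h z"
    and "0 < \<delta>" and "\<delta> < 1"
    and "DCAe_sequence f g h \<phi> L l \<delta> x"
  shows "(\<forall>k. objective f g h (x (Suc k))
            \<le> objective f g h (x k) + ereal (\<delta> * L * bregman \<phi> (prev x k) (x k))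
               - ereal (L * bregman \<phi> (x k) (x (Suc k))))
       \<and> (summable (\<lambda>k. (norm (x k - prev x k))\<^sup>2)
            \<and> (\<lambda>k. norm (x k - prev x k)) \<longlonglongrightarrow> 0)
       \<and> (\<forall>p. sequence_limit_point x p \<longrightarrow> critical_point f g h p)"
proof -
  have Df: "\<And>z. GDERIV f z :> grad f z" and Cf: "continuous_on UNIV (grad f)"
    using assms(1) by (auto simp: continuously_differentiable_def)
  have D\<phi>: "\<And>z. GDERIV \<phi> z :> grad \<phi> z" and C\<phi>: "continuous_on UNIV (grad \<phi>)"
    using assms(2) by (auto simp: continuously_differentiable_def)
  obtain \<rho> where \<rho>: "\<rho> > 0" and breg: "\<And>x y. \<rho> / 2 * (norm (x - y))\<^sup>2 \<le> bregman \<phi> x y"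
    using strongly_convex_bregman_ge[OF assms(3) D\<phi>] by blast
  have breg_nonneg: "0 \<le> bregman \<phi> u v" for u v
    using breg[of u v] \<rho> by (meson less_imp_le mult_nonneg_nonneg order_trans zero_le_power2
        divide_nonneg_nonneg zero_le_numeral)
  have upper: "f w - (f y + grad f y \<bullet> (w - y)) \<le> L * bregman \<phi> w y" for w y
    using linearization_error_le_bregman[of f y \<phi> L "- 1" w] Df D\<phi> assms(6) by simp
  have lower: "- (f w - (f y + grad f y \<bullet> (w - y))) \<le> l * bregman \<phi> w y" for w y
    using linearization_error_le_bregman[of f y \<phi> l 1 w] Df D\<phi> assms(7) by simp

  define d where "d k = L * bregman \<phi> (prev x k) (x k)" for k
  define iteration where "iteration k w v \<longleftrightarrow>
      (L + l) * bregman \<phi> (x k) w \<le> \<delta> * d k \<and> v \<in> subdiff (\<lambda>z. ereal (h z)) (x k) \<and>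
      is_arg_min
        (\<lambda>z. (ereal (L * \<phi> z) + g z) - ereal ((L *\<^sub>R grad \<phi> w - grad f w + v) \<bullet> z))
        (\<lambda>z. True) (x (Suc k))" for k w v
  have "\<exists>w v. iteration k w v" for k
    using assms(15) unfolding DCAe_sequence_def iteration_def d_def mult.assoc by blast
  then obtain y \<xi> where "\<And>k. iteration k (y k) (\<xi> k)" by metis
  then have ext: "\<And>k. (L + l) * bregman \<phi> (x k) (y k) \<le> \<delta> * d k"
    and \<xi>: "\<And>k. \<xi> k \<in> subdiff (\<lambda>z. ereal (h z)) (x k)"
    and arg: "\<And>k. is_arg_min
        (\<lambda>z. (ereal (L * \<phi> z) + g z)
              - ereal ((L *\<^sub>R grad \<phi> (y k) - grad f (y k) + \<xi> k) \<bullet> z))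
        (\<lambda>z. True) (x (Suc k))"
    unfolding iteration_def by blast+
  note opt = subproblem_optimality[OF assms(8,10) D\<phi> arg]
  have descent: "objective f g h (x (Suc k))
      \<le> objective f g h (x k) + ereal (\<delta> * d k) - ereal (L * bregman \<phi> (x k) (x (Suc k)))" for k
    by (rule descent_step[OF upper lower \<xi> opt ext])

  obtain m :: real where m: "\<And>z. ereal m \<le> objective f g h z" using assms(12) by blast
  \<comment> \<open>Only from \<open>x\<^sup>1\<close> on are the objective values guaranteed to be finite.\<close>
  define a where "a k = f (x (Suc k)) + real_of_ereal (g (x (Suc k))) - h (x (Suc k))" for k
  have a: "objective f g h (x (Suc k)) = ereal (a k)" for k
    using opt(1)[of k] by (cases "g (x (Suc k))") (auto simp: a_def objective_def)
  have "summable (\<lambda>k. d (Suc k))"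
  proof (rule summable_of_perturbed_descent)
    show "a (Suc n) \<le> a n + \<delta> * d (Suc n) - d (Suc (Suc n))" for n
      using descent[of "Suc n"] by (simp add: a d_def prev_def)
    show "m \<le> a n" for n using m[of "x (Suc n)"] by (simp add: a)
    show "0 \<le> d (Suc n)" for n using breg_nonneg assms(4) by (simp add: d_def)
    show "\<delta> < 1" by fact
  qed
  then have sum_d: "summable d" by (simp only: summable_Suc_iff)
  have step_le: "(norm (x k - prev x k))\<^sup>2 \<le> 2 / (\<rho> * L) * d k" for k
  proof -
    have "L * (\<rho> / 2 * (norm (prev x k - x k))\<^sup>2) \<le> d k"
      unfolding d_def using assms(4) breg by (intro mult_left_mono) auto
    then show ?thesis using \<rho> assms(4) by (simp add: field_simps norm_minus_commute)
  qed
  have sum_step: "summable (\<lambda>k. (norm (x k - prev x k))\<^sup>2)"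
  proof (rule summable_comparison_test')
    show "summable (\<lambda>k. 2 / (\<rho> * L) * d k)" using sum_d by (rule summable_mult)
  qed (use step_le in simp)
  have step_lim: "(\<lambda>k. norm (x k - prev x k)) \<longlonglongrightarrow> 0"
    using tendsto_real_sqrt[OF summable_LIMSEQ_zero[OF sum_step]] by simp

  have "critical_point f g h p" if lim: "sequence_limit_point x p" for p
  proof -
    have h_cont: "continuous_on UNIV h"
      using assms(11) by (rule convex_on_continuous[OF open_UNIV])
    obtain r where r: "strict_mono r" "(x \<circ> r) \<longlonglongrightarrow> p"
      using lim by (auto simp: sequence_limit_point_def)
    have "bounded (range (\<xi> \<circ> r))"
    proof (rule bounded_subset)
      show "bounded (\<Union>w\<in>range (x \<circ> r). subdiff (\<lambda>z. ereal (h z)) w)"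
        using h_cont convergent_imp_bounded[OF r(2)] by (rule subgradients_bounded)
    qed (use \<xi> in auto)
    then obtain v s where s: "strict_mono s" "((\<xi> \<circ> r) \<circ> s) \<longlonglongrightarrow> v"
      using bounded_imp_convergent_subsequence by blast
    define t where "t = r \<circ> s"
    have t: "strict_mono t" using r(1) s(1) by (simp add: t_def strict_mono_o)
    have x_lim: "(\<lambda>n. x (t n)) \<longlonglongrightarrow> p"
      using LIMSEQ_subseq_LIMSEQ[OF r(2) s(1)] by (simp add: t_def o_def)
    have \<xi>_lim: "(\<lambda>n. \<xi> (t n)) \<longlonglongrightarrow> v" using s(2) by (simp add: t_def o_def)
    have "(\<lambda>k. x (Suc k) - x k) \<longlonglongrightarrow> 0"
      using LIMSEQ_Suc[OF step_lim] by (simp add: prev_def tendsto_norm_zero_iff)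
    then have "(\<lambda>n. x (Suc (t n)) - x (t n)) \<longlonglongrightarrow> 0"
      using LIMSEQ_subseq_LIMSEQ[OF _ t] by (auto simp: o_def)
    from tendsto_add[OF this x_lim] have next_lim: "(\<lambda>n. x (Suc (t n))) \<longlonglongrightarrow> p" by simp
    have "(\<lambda>k. (norm (y k - x k))\<^sup>2) \<longlonglongrightarrow> 0"
    proof (rule tendsto_sandwich[where f = "\<lambda>_. 0"])
      have c: "(L + l) * (\<rho> / 2) > 0" using assms(4,5) \<rho> by simp
      have "(norm (y k - x k))\<^sup>2 \<le> \<delta> / ((L + l) * (\<rho> / 2)) * d k" for k
      proof -
        have "(L + l) * (\<rho> / 2 * (norm (x k - y k))\<^sup>2) \<le> (L + l) * bregman \<phi> (x k) (y k)"
          using assms(4,5) breg by (intro mult_left_mono) auto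
        also note ext[of k]
        finally have "(norm (y k - x k))\<^sup>2 * ((L + l) * (\<rho> / 2)) \<le> \<delta> * d k"
          by (simp add: norm_minus_commute mult_ac)
        then show ?thesis using c by (simp add: pos_le_divide_eq)
      qed
      then show "eventually (\<lambda>k. (norm (y k - x k))\<^sup>2 \<le> \<delta> / ((L + l) * (\<rho> / 2)) * d k) sequentially"
        by simp
      show "(\<lambda>k. \<delta> / ((L + l) * (\<rho> / 2)) * d k) \<longlonglongrightarrow> 0"
        by (rule tendsto_mult_right_zero[OF summable_LIMSEQ_zero[OF sum_d]])
    qed auto
    from tendsto_real_sqrt[OF this] have "(\<lambda>k. y k - x k) \<longlonglongrightarrow> 0"
      by (simp add: tendsto_norm_zero_iff)
    then have "(\<lambda>n. y (t n) - x (t n)) \<longlonglongrightarrow> 0"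
      using LIMSEQ_subseq_LIMSEQ[OF _ t] by (auto simp: o_def)
    from tendsto_add[OF this x_lim] have y_lim: "(\<lambda>n. y (t n)) \<longlonglongrightarrow> p" by simp
    have "v \<in> subdiff (\<lambda>z. ereal (h z)) p"
      using continuous_imp_lsc[OF h_cont] x_lim \<xi>_lim \<xi> by (rule subdiff_limit)
    moreover have "v - grad f p \<in> subdiff g p"
    proof (rule subdiff_limit[OF assms(9) next_lim _ opt(2)])
      have "(\<lambda>n. L *\<^sub>R grad \<phi> (y (t n)) - grad f (y (t n)) + \<xi> (t n) - L *\<^sub>R grad \<phi> (x (Suc (t n))))
          \<longlonglongrightarrow> L *\<^sub>R grad \<phi> p - grad f p + v - L *\<^sub>R grad \<phi> p"
        by (intro tendsto_intros \<xi>_lim continuous_on_tendsto_compose[OF C\<phi> y_lim]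
            continuous_on_tendsto_compose[OF C\<phi> next_lim]
            continuous_on_tendsto_compose[OF Cf y_lim]) auto
      then show "(\<lambda>n. L *\<^sub>R grad \<phi> (y (t n)) - grad f (y (t n)) + \<xi> (t n)
          - L *\<^sub>R grad \<phi> (x (Suc (t n)))) \<longlonglongrightarrow> v - grad f p"
        by (simp add: algebra_simps)
    qed
    then have "v \<in> (\<lambda>u. grad f p + u) ` subdiff g p"
      by (rule rev_image_eqI) simp
    ultimately show ?thesis by (auto simp: critical_point_def)
  qed
  moreover have "objective f g h (x (Suc k))
      \<le> objective f g h (x k) + ereal (\<delta> * L * bregman \<phi> (prev x k) (x k))
         - ereal (L * bregman \<phi> (x k) (x (Suc k)))" for k
    using descent[of k] by (simp add: d_def mult.assoc)
  ultimately show ?thesis using sum_step step_lim by blast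
qed

end
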